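(* Let $\phi:[-1,1]\to\mathbb{R}$ be a convex, non-positive, non-constant, differentiable, Lipschitz function with Lipschitz constant $L(\phi)$. Given $\epsilon>0$, there exists a set $\mathcal{T}_\epsilon(\phi)\subset[-1,1]$ of size $O\big(\sqrt{L(\phi)/\epsilon}\,\log(L(\phi)/\epsilon)\big)$ such that $$0\le\phi(\rho)-\sup_{\rho_0\in\mathcal{T}_\epsilon(\phi)}h_{\rho_0}(\rho)\le2\epsilon\quad\text{for all }\rho\in[-1,1].$$
   Context: For $\gamma\ge0,t>0$ let $h_{\gamma,t}(\rho)=-\Big(\frac{1-\rho}{1+\rho}+\gamma^2\frac{1+\rho}{1-\rho}\Big)\frac{t^2}{2}$. For $\rho_0\in(-1,1)$ define $\gamma_0^2=\Big(\frac{1-\rho_0}{1+\rho_0}\Big)^2\frac{2\phi(\rho_0)+(1-\rho_0^2)\phi'(\rho_0)}{2\phi(\rho_0)-(1-\rho_0^2)\phi'(\rho_0)}$ and $t_0^2=-\frac12\frac{1+\rho_0}{1-\rho_0}\big[2\phi(\rho_0)-(1-\rho_0^2)\phi'(\rho_0)\big]$ (these are well defined with $\gamma_0^2\ge0$, $t_0^2>0$ under the hypotheses on $\phi$), and set $h_{\rho_0}:=h_{\gamma_0,t_0}$. For the boundary points define $h_{\pm1}(\rho)=-\frac{1\mp\rho}{1\pm\rho}\frac{t_{\pm1}^2}{2}+\phi(\pm1)$ with $t_{\pm1}^2=4\max\{\pm\phi'(\pm1),0\}$. $L(\phi)$ is the minimal Lipschitz constant of $\phi$.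
   Formalization: The constant in O(·) may depend, monotonically, on sup|φ|/L(φ), since an absolute constant fails for φ(ρ) = −M+ρ as M→∞; the size bound is stated for L(φ)/ε above an absolute threshold, and the set is only claimed finite below it. *)

theory Defs
  imports "HOL-Analysis.Analysis"
begin

definition lip_const :: "(real \<Rightarrow> real) \<Rightarrow> real" where
  "lip_const \<phi> = Inf {L. L-lipschitz_on {-1..1} \<phi>}"

text \<open>The derivative is one-sided at the end points.\<close>

definition dphi :: "(real \<Rightarrow> real) \<Rightarrow> real \<Rightarrow> real" where
  "dphi \<phi> \<rho> = vector_derivative \<phi> (at \<rho> within {-1..1})"

text \<open>
  The functions below are extended-real valued because they have poles at the end points of the
  interval. In \<^typ>\<open>ereal\<close> one has \<open>2 / 0 = \<infinity>\<close> and \<open>0 * \<infinity> = 0\<close>, so the value at a pole is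
  \<open>-\<infinity>\<close> if its coefficient is positive, and a term with coefficient \<open>0\<close> vanishes
  identically. The \<^typ>\<open>real\<close> convention \<open>2 / 0 = 0\<close> would give a wrong value there.
\<close>

definition h_gt :: "real \<Rightarrow> real \<Rightarrow> real \<Rightarrow> ereal" where
  "h_gt \<gamma> t \<rho> =
     - ((ereal (1 - \<rho>) / ereal (1 + \<rho>)
          + ereal (\<gamma>\<^sup>2) * (ereal (1 + \<rho>) / ereal (1 - \<rho>))) * ereal (t\<^sup>2 / 2))"

definition gamma0_sq :: "(real \<Rightarrow> real) \<Rightarrow> real \<Rightarrow> real" where
  "gamma0_sq \<phi> \<rho>\<^sub>0 =
     ((1 - \<rho>\<^sub>0) / (1 + \<rho>\<^sub>0))\<^sup>2 *
     ((2 * \<phi> \<rho>\<^sub>0 + (1 - \<rho>\<^sub>0\<^sup>2) * dphi \<phi> \<rho>\<^sub>0) / (2 * \<phi> \<rho>\<^sub>0 - (1 - \<rho>\<^sub>0\<^sup>2) * dphi \<phi> \<rho>\<^sub>0))"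

definition t0_sq :: "(real \<Rightarrow> real) \<Rightarrow> real \<Rightarrow> real" where
  "t0_sq \<phi> \<rho>\<^sub>0 =
     - (1 / 2) * ((1 + \<rho>\<^sub>0) / (1 - \<rho>\<^sub>0)) * (2 * \<phi> \<rho>\<^sub>0 - (1 - \<rho>\<^sub>0\<^sup>2) * dphi \<phi> \<rho>\<^sub>0)"

definition h_plus1 :: "(real \<Rightarrow> real) \<Rightarrow> real \<Rightarrow> ereal" where
  "h_plus1 \<phi> \<rho> =
     - ((ereal (1 - \<rho>) / ereal (1 + \<rho>)) * ereal (4 * max (dphi \<phi> 1) 0 / 2)) + ereal (\<phi> 1)"

definition h_minus1 :: "(real \<Rightarrow> real) \<Rightarrow> real \<Rightarrow> ereal" where
  "h_minus1 \<phi> \<rho> =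
     - ((ereal (1 + \<rho>) / ereal (1 - \<rho>)) * ereal (4 * max (- dphi \<phi> (-1)) 0 / 2)) + ereal (\<phi> (-1))"

definition h_at :: "(real \<Rightarrow> real) \<Rightarrow> real \<Rightarrow> real \<Rightarrow> ereal" where
  "h_at \<phi> \<rho>\<^sub>0 =
     (if \<rho>\<^sub>0 = 1 then h_plus1 \<phi>
      else if \<rho>\<^sub>0 = -1 then h_minus1 \<phi>
      else h_gt (sqrt (gamma0_sq \<phi> \<rho>\<^sub>0)) (sqrt (t0_sq \<phi> \<rho>\<^sub>0)))"

end

theory Submission
  imports Defs
begin

text \<open>
  With \<open>q = ((1 + \<rho>) (1 - \<rho>\<^sub>0)) / ((1 - \<rho>) (1 + \<rho>\<^sub>0))\<close>, the function \<open>h\<close> at an interior point \<open>\<rho>\<^sub>0\<close>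
  lies below the tangent of \<open>\<phi>\<close> at \<open>\<rho>\<^sub>0\<close> by exactly
  \<open>(q - 1)\<^sup>2 / (4 q) * (- 2 \<phi>(\<rho>\<^sub>0) - \<rho> (1 - \<rho>\<^sub>0\<^sup>2) \<phi>'(\<rho>\<^sub>0))\<close>, which is nonnegative since \<open>\<phi>(\<plusminus>1) \<le> 0\<close>
  and at most \<open>e\<^sup>2 (2 M + L)\<close> if \<open>|ln q| \<le> e \<le> 1\<close>, where \<open>M = sup |\<phi>|\<close>. Then also
  \<open>|\<rho> - \<rho>\<^sub>0| \<le> 2 e\<close>, so by convexity \<open>\<phi>\<close> exceeds its tangent by at most \<open>2 e w\<close> if \<open>\<phi>'\<close> differs by
  at most \<open>w\<close> between \<open>\<rho>\<close> and \<open>\<rho>\<^sub>0\<close>. Hence it suffices to take one point from each common cell of a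
  grid of width \<open>e\<close> in \<open>ln ((1 + \<rho>) / (1 - \<rho>))\<close> and a grid of width \<open>w\<close> in the values of \<open>\<phi>'\<close>, with
  \<open>e\<^sup>2 = \<epsilon> / (2 M + L)\<close> and \<open>w\<^sup>2 = \<epsilon> L / 4\<close>. The functions at the end points handle the points at
  distance less than \<open>2 \<epsilon> / (3 L)\<close> from \<open>\<plusminus>1\<close>, so the first grid has \<open>O(ln (L / \<epsilon>) / e)\<close> cells.
\<close>

section \<open>One-sided derivatives, Lipschitz constants and step functions\<close>

text \<open>Along the chord the derivative becomes a limit of difference quotients at 0 from the
  right, each at most \<open>K\<close>. As only one side is used, \<open>c\<close> may be an end
  point of an interval; convexity and the Lipschitz condition each supply a suitable
  \<open>K\<close>.\<close>

lemma derivative_within_le_of_chord: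
  fixes f :: "real \<Rightarrow> real"
  assumes f: "(f has_real_derivative D) (at c within A)"
    and seg: "\<And>t. 0 \<le> t \<Longrightarrow> t \<le> 1 \<Longrightarrow> c + t * (y - c) \<in> A"
    and K: "\<And>t. 0 < t \<Longrightarrow> t \<le> 1 \<Longrightarrow> f (c + t * (y - c)) - f c \<le> t * K"
  shows "D * (y - c) \<le> K"
proof -
  have g: "((\<lambda>t. f (c + t * (y - c))) has_real_derivative D * (y - c)) (at 0 within {0..1})"
  proof (rule DERIV_image_chain[where f = f and g = "\<lambda>t. c + t * (y - c)", unfolded o_def])
    show "((\<lambda>t. c + t * (y - c)) has_real_derivative (y - c)) (at 0 within {0..1})"
      by (auto intro!: derivative_eq_intros)
    show "(f has_real_derivative D) (at (c + 0 * (y - c)) within (\<lambda>t. c + t * (y - c)) ` {0..1})"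
      using seg by (auto intro: has_field_derivative_subset[OF f])
  qed
  then have "((\<lambda>t. (f (c + t * (y - c)) - f c) / t) \<longlongrightarrow> D * (y - c)) (at 0 within {0..1})"
    by (simp add: has_field_derivative_iff)
  moreover have "\<forall>\<^sub>F t in at 0 within {0..1}. (f (c + t * (y - c)) - f c) / t \<le> K"
    unfolding eventually_at
    by (rule exI[of _ 1]) (use K in \<open>auto simp: divide_simps mult.commute\<close>)
  moreover have "at (0::real) within {0..1} \<noteq> bot"
    by (simp add: trivial_limit_within islimpt_Icc)
  ultimately show ?thesis
    by (intro tendsto_upperbound)
qed

text \<open>Convexity bounds the increments along the chord with
  \<open>K = f y - f c\<close>.\<close>

lemma convex_on_above_tangent:
  fixes f :: "real \<Rightarrow> real"
  assumes "convex_on A f" "(f has_real_derivative D) (at c within A)" "c \<in> A" "y \<in> A"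
  shows "f c + D * (y - c) \<le> f y"
proof -
  have eq: "c + t * (y - c) = (1 - t) *\<^sub>R c + t *\<^sub>R y" for t
    by (simp add: algebra_simps)
  have "D * (y - c) \<le> f y - f c"
  proof (rule derivative_within_le_of_chord[OF assms(2)])
    show "c + t * (y - c) \<in> A" if "0 \<le> t" "t \<le> 1" for t
      unfolding eq using convexD_alt[OF convex_on_imp_convex[OF assms(1)] assms(3,4) that] .
    show "f (c + t * (y - c)) - f c \<le> t * (f y - f c)" if "0 < t" "t \<le> 1" for t
      unfolding eq using convex_onD[OF assms(1), of t c y] assms(3,4) that
      by (simp add: algebra_simps)
  qed
  then show ?thesis by simp
qed

text \<open>The chord bound with \<open>K = L * \<bar>y - c\<bar>\<close> applies to both
  \<open>f\<close> and \<open>- f\<close>; dividing by the nonzero length of the chord gives the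
  claim.\<close>

lemma lipschitz_on_derivative_le:
  fixes f :: "real \<Rightarrow> real"
  assumes "L-lipschitz_on A f" "(f has_real_derivative D) (at c within A)"
    "convex A" "c \<in> A" "y \<in> A" "y \<noteq> c"
  shows "\<bar>D\<bar> \<le> L"
proof -
  have eq: "c + t * (y - c) = (1 - t) *\<^sub>R c + t *\<^sub>R y" for t
    by (simp add: algebra_simps)
  have seg: "c + t * (y - c) \<in> A" if "0 \<le> t" "t \<le> 1" for t
    unfolding eq using convexD_alt[OF assms(3,4,5) that] .
  have lip: "\<bar>f (c + t * (y - c)) - f c\<bar> \<le> t * (L * \<bar>y - c\<bar>)" if "0 < t" "t \<le> 1" for t
    using lipschitz_onD[OF assms(1) seg assms(4), of t] that
    by (simp add: dist_real_def abs_mult mult.left_commute)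
  have "D * (y - c) \<le> L * \<bar>y - c\<bar>"
    by (rule derivative_within_le_of_chord[OF assms(2) seg]) (use lip in \<open>fastforce+\<close>)
  moreover have "- D * (y - c) \<le> L * \<bar>y - c\<bar>"
    by (rule derivative_within_le_of_chord[OF DERIV_minus[OF assms(2)] seg])
      (use lip in \<open>fastforce+\<close>)
  ultimately have "\<bar>D\<bar> * \<bar>y - c\<bar> \<le> L * \<bar>y - c\<bar>"
    by (simp flip: abs_mult)
  then show ?thesis
    using assms(6) by simp
qed

text \<open>For distinct points the quotient of distances is a lower bound of the set of Lipschitz
  constants, so the infimum is attained and \<open>lip_const\<close> can serve as
  \<open>L\<close>.\<close>

lemma Inf_lipschitz_on:
  fixes f :: "'a::metric_space \<Rightarrow> 'b::metric_space"
  assumes "\<exists>L. L-lipschitz_on A f"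
  shows "(Inf {L. L-lipschitz_on A f})-lipschitz_on A f"
proof (rule lipschitz_onI)
  have ne: "{L. L-lipschitz_on A f} \<noteq> {}"
    using assms by auto
  show "0 \<le> Inf {L. L-lipschitz_on A f}"
    by (rule cInf_greatest[OF ne]) (auto simp: lipschitz_on_def)
  show "dist (f x) (f y) \<le> Inf {L. L-lipschitz_on A f} * dist x y" if "x \<in> A" "y \<in> A" for x y
  proof (cases "x = y")
    case False
    have "dist (f x) (f y) / dist x y \<le> Inf {L. L-lipschitz_on A f}"
      by (rule cInf_greatest[OF ne])
        (use that False in \<open>auto simp: lipschitz_on_def divide_simps\<close>)
    then show ?thesis
      using False by (simp add: divide_simps)
  qed simp
qed

text \<open>Two monotone step functions with equal sums at two points agree at those points, so it is
  enough to pick one representative for each value of the sum.\<close>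

lemma finite_representatives_of_steps:
  fixes f g :: "'a::linorder \<Rightarrow> real" and S :: "'a set"
  assumes f: "mono_on S f" "\<And>x. x \<in> S \<Longrightarrow> \<bar>f x\<bar> \<le> a"
    and g: "mono_on S g" "\<And>x. x \<in> S \<Longrightarrow> \<bar>g x\<bar> \<le> b"
    and "0 \<le> a" "0 \<le> b"
  obtains T where "T \<subseteq> S" "finite T" "real (card T) \<le> 2 * a + 2 * b + 3"
    "\<And>x. x \<in> S \<Longrightarrow> \<exists>y\<in>T. \<bar>f x - f y\<bar> \<le> 1 \<and> \<bar>g x - g y\<bar> \<le> 1"
proof -
  define k where "k x = \<lfloor>f x\<rfloor> + \<lfloor>g x\<rfloor>" for x
  define T where "T = inv_into S k ` (k ` S)"
  have k_range: "k ` S \<subseteq> {\<lfloor>- a\<rfloor> + \<lfloor>- b\<rfloor> .. \<lfloor>a\<rfloor> + \<lfloor>b\<rfloor>}"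
    unfolding k_def using f(2) g(2)
    by (auto intro!: add_mono floor_mono simp: abs_le_iff minus_le_iff)
  have fin: "finite (k ` S)"
    using k_range finite_subset by blast
  have "card T \<le> card (k ` S)"
    unfolding T_def using fin by (rule card_image_le)
  also have "\<dots> \<le> nat (\<lfloor>a\<rfloor> + \<lfloor>b\<rfloor> + 1 - (\<lfloor>- a\<rfloor> + \<lfloor>- b\<rfloor>))"
    using card_mono[OF _ k_range] by simp
  finally have "real (card T) \<le> real (nat (\<lfloor>a\<rfloor> + \<lfloor>b\<rfloor> + 1 - (\<lfloor>- a\<rfloor> + \<lfloor>- b\<rfloor>)))"
    by simp
  \<comment> \<open>Each of the two lower floors loses at most 1, and counting the integers of a
    closed interval adds 1.\<close>
  also have "\<dots> \<le> 2 * a + 2 * b + 3"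
    using \<open>0 \<le> a\<close> \<open>0 \<le> b\<close> by linarith
  finally have card: "real (card T) \<le> 2 * a + 2 * b + 3" .
  have same: "\<bar>f x - f y\<bar> \<le> 1 \<and> \<bar>g x - g y\<bar> \<le> 1"
    if "x \<in> S" "y \<in> S" "x \<le> y" "k x = k y" for x y
  proof -
    have "\<lfloor>f x\<rfloor> \<le> \<lfloor>f y\<rfloor>" "\<lfloor>g x\<rfloor> \<le> \<lfloor>g y\<rfloor>"
      using that f(1) g(1) by (auto intro!: floor_mono dest: mono_onD)
    then have "\<lfloor>f x\<rfloor> = \<lfloor>f y\<rfloor>" "\<lfloor>g x\<rfloor> = \<lfloor>g y\<rfloor>"
      using that(4) unfolding k_def by linarith+
    then show ?thesis by linarith
  qed
  show ?thesis
  proof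
    show "T \<subseteq> S"
      unfolding T_def by (auto intro: inv_into_into)
    show "finite T"
      unfolding T_def using fin by simp
    show "real (card T) \<le> 2 * a + 2 * b + 3" by (rule card)
    show "\<exists>y\<in>T. \<bar>f x - f y\<bar> \<le> 1 \<and> \<bar>g x - g y\<bar> \<le> 1" if "x \<in> S" for x
    proof -
      define y where "y = inv_into S k (k x)"
      have "y \<in> T" "y \<in> S" "k y = k x"
        using that unfolding y_def T_def by (auto intro: inv_into_into f_inv_into_f)
      moreover have "\<bar>f x - f y\<bar> \<le> 1 \<and> \<bar>g x - g y\<bar> \<le> 1"
        using same[of x y] same[of y x] calculation that linear[of x y]
        by (auto simp: abs_minus_commute)
      ultimately show ?thesis by blast
    qed
  qed
qed

section \<open>The odds coordinate\<close>

text \<open>\<open>ln (odds r)\<close> is twice the inverse hyperbolic tangent of \<open>r\<close>.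
  For fixed interior \<open>s\<close>, \<open>h_at \<phi> s r\<close> depends on \<open>r\<close>
  only through \<open>odds r / odds s\<close>.\<close>

definition odds :: "real \<Rightarrow> real" where
  "odds r = (1 + r) / (1 - r)"

lemma odds_pos: "-1 < r \<Longrightarrow> r < 1 \<Longrightarrow> 0 < odds r"
  by (simp add: odds_def)

lemma odds_mono: "-1 < r \<Longrightarrow> r \<le> s \<Longrightarrow> s < 1 \<Longrightarrow> odds r \<le> odds s"
  unfolding odds_def by (intro frac_le) auto

text \<open>For \<open>y \<le> x\<close> the ratio minus 1 equals
  \<open>2 * (x - y) / ((1 - x) * (1 + y))\<close>, whose denominator is at most 2. The disjunction
  covers both orders of the points.\<close>

lemma odds_ratio_diff_le:
  assumes r: "-1 < r" "r < 1" and s: "-1 < s" "s < 1"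
  shows "\<bar>r - s\<bar> \<le> odds r / odds s - 1 \<or> \<bar>r - s\<bar> \<le> odds s / odds r - 1"
proof -
  have *: "x - y \<le> odds x / odds y - 1" if "-1 < y" "y \<le> x" "x < 1" for x y
  proof -
    have "odds x / odds y - 1 = 2 * (x - y) / ((1 - x) * (1 + y))"
      using that unfolding odds_def by (simp add: divide_simps) (simp add: algebra_simps)
    moreover have "(1 - x) * (1 + y) \<le> 2"
    proof -
      have "(1 - x) * (1 + y) \<le> (1 - y) * (1 + y)"
        using that by (intro mult_right_mono) auto
      also have "\<dots> \<le> 2"
        using zero_le_power2[of y] by (simp add: algebra_simps power2_eq_square)
      finally show ?thesis .
    qed
    moreover have "0 < (1 - x) * (1 + y)"
      using that by simp
    moreover have "(x - y) * ((1 - x) * (1 + y)) \<le> (x - y) * 2"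
      using that calculation by (intro mult_left_mono) auto
    ultimately show ?thesis
      by (simp add: pos_le_divide_eq mult.commute)
  qed
  show ?thesis
    using *[of r s] *[of s r] assms by (cases "r \<le> s") auto
qed

lemma exp_minus_one_le: "0 \<le> x \<Longrightarrow> x \<le> 1 \<Longrightarrow> exp x - 1 \<le> 2 * (x::real)"
  using exp_bound[of x] mult_left_le[of x x] by (auto simp: power2_eq_square)

text \<open>The ratio \<open>q\<close> and its inverse are both at most \<open>exp e\<close>, hence
  at most \<open>1 + 2 * e\<close>. Since \<open>(q - 1)\<^sup>2 / q\<close> is unchanged when
  \<open>q\<close> is inverted, the case of \<open>q\<close> below 1 reduces to the other
  one.\<close>

lemma odds_close:
  assumes r: "-1 < r" "r < 1" and s: "-1 < s" "s < 1"
    and d: "\<bar>ln (odds r) - ln (odds s)\<bar> \<le> e" "e \<le> 1"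
  shows "\<bar>r - s\<bar> \<le> 2 * e"
    and "(odds r / odds s - 1)\<^sup>2 / (4 * (odds r / odds s)) \<le> e\<^sup>2"
proof -
  define q where "q = odds r / odds s"
  have pos: "0 < odds r" "0 < odds s" "0 < q"
    using odds_pos r s unfolding q_def by auto
  have e: "0 \<le> e" using d by linarith
  have lnq: "ln q = ln (odds r) - ln (odds s)"
    using pos unfolding q_def by (simp add: ln_div)
  have q1: "q - 1 \<le> 2 * e"
  proof -
    have "q = exp (ln q)" using pos by simp
    also have "\<dots> \<le> exp e" using d lnq by simp
    finally show ?thesis using exp_minus_one_le[OF e d(2)] by simp
  qed
  have q2: "1 / q - 1 \<le> 2 * e"
  proof -
    have "1 / q = exp (- ln q)" using pos by (simp add: exp_minus inverse_eq_divide)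
    also have "\<dots> \<le> exp e" using d lnq by simp
    finally show ?thesis using exp_minus_one_le[OF e d(2)] by simp
  qed
  show "\<bar>r - s\<bar> \<le> 2 * e"
    using odds_ratio_diff_le[OF r s] q1 q2 unfolding q_def by auto
  have "(q - 1)\<^sup>2 / q \<le> (2 * e)\<^sup>2"
  proof (cases "1 \<le> q")
    case True
    then have "(q - 1)\<^sup>2 / q \<le> (q - 1)\<^sup>2 / 1"
      by (intro divide_left_mono) auto
    also have "\<dots> \<le> (2 * e)\<^sup>2"
      using power_mono[OF q1, of 2] True by simp
    finally show ?thesis .
  next
    case False
    have "(q - 1)\<^sup>2 / q = q * (1 / q - 1)\<^sup>2"
      using pos by (simp add: power2_eq_square field_simps)
    also have "\<dots> \<le> 1 * (2 * e)\<^sup>2"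
      using False pos q2 by (intro mult_mono power_mono) auto
    finally show ?thesis by simp
  qed
  then show "(odds r / odds s - 1)\<^sup>2 / (4 * (odds r / odds s)) \<le> e\<^sup>2"
    unfolding q_def[symmetric] by (simp add: power_mult_distrib)
qed

section \<open>Sign and slope bounds for the given function\<close>

text \<open>\<open>L\<close> and \<open>M\<close> are arbitrary bounds rather than optimal ones, so
  that the reflected function is an instance with the same parameters.\<close>

locale convex_profile =
  fixes \<phi> :: "real \<Rightarrow> real" and L M :: real
  assumes convex: "convex_on {-1..1} \<phi>"
    and nonpos: "\<And>r. r \<in> {-1..1} \<Longrightarrow> \<phi> r \<le> 0"
    and nonconst: "\<not> \<phi> constant_on {-1..1}"
    and diff: "\<phi> differentiable_on {-1..1}"
    and lip: "L-lipschitz_on {-1..1} \<phi>"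
    and bound: "\<And>r. r \<in> {-1..1} \<Longrightarrow> \<bar>\<phi> r\<bar> \<le> M"
begin

abbreviation "D \<equiv> dphi \<phi>"

lemma has_derivative_D:
  assumes "r \<in> {-1..1}"
  shows "(\<phi> has_real_derivative D r) (at r within {-1..1})"
  using assms diff unfolding dphi_def differentiable_on_def
  by (auto simp: vector_derivative_works has_real_derivative_iff_has_vector_derivative)

lemma tangent_le: "r \<in> {-1..1} \<Longrightarrow> s \<in> {-1..1} \<Longrightarrow> \<phi> s + D s * (r - s) \<le> \<phi> r"
  using convex_on_above_tangent[OF convex has_derivative_D] by blast

lemma abs_D_le:
  assumes "r \<in> {-1..1}"
  shows "\<bar>D r\<bar> \<le> L"
proof -
  obtain y :: real where "y \<in> {-1..1}" "y \<noteq> r"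
    by (rule that[of "if r = 1 then 0 else 1"]) auto
  then show ?thesis
    using lipschitz_on_derivative_le[OF lip has_derivative_D] assms by (simp add: convex_real_interval)
qed

text \<open>Adding the tangent inequalities at \<open>r\<close> and at \<open>s\<close> gives
  this.\<close>

lemma D_mono: "mono_on {-1..1} D"
proof (rule mono_onI)
  fix r s :: real
  assume rs: "r \<in> {-1..1}" "s \<in> {-1..1}" "r \<le> s"
  have "D r * (s - r) \<le> D s * (s - r)"
    using tangent_le[of s r] tangent_le[of r s] rs by (simp add: algebra_simps)
  then show "D r \<le> D s"
    using rs by (cases "r = s") auto
qed

lemma L_pos: "0 < L"
proof (rule ccontr)
  assume "\<not> 0 < L"
  then have "L = 0"
    using lip by (auto simp: lipschitz_on_def)
  then have "\<phi> x = \<phi> 0" if "x \<in> {-1..1}" for x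
    using lipschitz_onD[OF lip that, of 0] by simp
  then show False
    using nonconst unfolding constant_on_def by blast
qed

lemma M_nonneg: "0 \<le> M"
  using bound[of 0] by simp

text \<open>At an interior zero the tangent must be nonpositive at both ends, so its slope is 0.
  Then \<open>\<phi>\<close> lies above the zero line as well as below it and is constant.\<close>

lemma interior_neg:
  assumes "-1 < s" "s < 1"
  shows "\<phi> s < 0"
proof (rule ccontr)
  assume "\<not> \<phi> s < 0"
  then have z: "\<phi> s = 0"
    using nonpos[of s] assms by simp
  have "D s * (1 - s) \<le> 0" "D s * (-1 - s) \<le> 0"
    using tangent_le[of 1 s] tangent_le[of "-1" s] nonpos[of 1] nonpos[of "-1"] assms z by auto
  then have "D s = 0"
    using assms by (auto simp: mult_le_0_iff)
  then have "\<phi> x = 0" if "x \<in> {-1..1}" for x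
    using tangent_le[of x s] nonpos[of x] assms z that by force
  then show False
    using nonconst unfolding constant_on_def by auto
qed

text \<open>The tangent at \<open>s\<close> is nonpositive at 1 and at -1. Multiplying these two
  inequalities by \<open>1 + s\<close> and \<open>1 - s\<close>, both less than 2, gives the bounds;
  strictness comes from \<open>\<phi> s < 0\<close>. They make \<open>gamma0_sq\<close> and
  \<open>t0_sq\<close> positive, so the square roots in \<open>h_at\<close> are genuine.\<close>

lemma coefficients_neg:
  assumes "-1 < s" "s < 1"
  shows "2 * \<phi> s + (1 - s\<^sup>2) * D s < 0" "2 * \<phi> s - (1 - s\<^sup>2) * D s < 0"
proof -
  note neg = interior_neg[OF assms]
  have "D s * (1 - s) \<le> - \<phi> s" "- D s * (1 + s) \<le> - \<phi> s"
    using tangent_le[of 1 s] tangent_le[of "-1" s] nonpos[of 1] nonpos[of "-1"] assms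
    by (auto simp: algebra_simps)
  then have "(1 + s) * (D s * (1 - s)) \<le> (1 + s) * (- \<phi> s)"
    "(1 - s) * (- D s * (1 + s)) \<le> (1 - s) * (- \<phi> s)"
    using assms by (intro mult_left_mono; simp)+
  moreover have "(1 + s) * (- \<phi> s) < 2 * (- \<phi> s)" "(1 - s) * (- \<phi> s) < 2 * (- \<phi> s)"
    using assms neg by (intro mult_strict_right_mono; simp)+
  moreover have "(1 + s) * (D s * (1 - s)) = (1 - s\<^sup>2) * D s"
    "(1 - s) * (- D s * (1 + s)) = - ((1 - s\<^sup>2) * D s)"
    by (simp_all add: algebra_simps power2_eq_square)
  ultimately show "2 * \<phi> s + (1 - s\<^sup>2) * D s < 0" "2 * \<phi> s - (1 - s\<^sup>2) * D s < 0"
    by linarith+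
qed

lemma gamma0_sq_pos: "-1 < s \<Longrightarrow> s < 1 \<Longrightarrow> 0 < gamma0_sq \<phi> s"
  unfolding gamma0_sq_def using coefficients_neg[of s] by (intro mult_pos_pos divide_neg_neg) auto

lemma t0_sq_pos: "-1 < s \<Longrightarrow> s < 1 \<Longrightarrow> 0 < t0_sq \<phi> s"
  unfolding t0_sq_def using coefficients_neg[of s]
  by (intro mult_neg_neg mult_neg_pos divide_pos_pos) auto

section \<open>Comparison with the tangent at an interior point\<close>

lemma h_at_interior:
  assumes s: "-1 < s" "s < 1" and r: "-1 < r" "r < 1"
  defines "q \<equiv> odds r / odds s"
  shows "h_at \<phi> s r = ereal (\<phi> s * (q + 1 / q) / 2 + (1 - s\<^sup>2) * D s / 4 * (q - 1 / q))"
proof -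
  \<comment> \<open>\<open>P\<close> and \<open>N\<close> are the numerator and denominator in
    \<open>gamma0_sq\<close>. The function becomes \<open>(N / q + P * q) / 4\<close>, and splitting
    it by the sum and difference of \<open>P\<close> and \<open>N\<close> gives the claimed
    form.\<close>
  define P N where "P = 2 * \<phi> s + (1 - s\<^sup>2) * D s" and "N = 2 * \<phi> s - (1 - s\<^sup>2) * D s"
  have N: "N \<noteq> 0"
    using coefficients_neg[OF s] unfolding N_def by simp
  have sq: "(sqrt (gamma0_sq \<phi> s))\<^sup>2 = gamma0_sq \<phi> s" "(sqrt (t0_sq \<phi> s))\<^sup>2 = t0_sq \<phi> s"
    using gamma0_sq_pos[OF s] t0_sq_pos[OF s] by auto
  have g: "gamma0_sq \<phi> s = P / N / (odds s)\<^sup>2"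
    unfolding gamma0_sq_def P_def N_def odds_def by (simp add: power_divide mult.commute)
  have t: "t0_sq \<phi> s = - (1 / 2) * odds s * N"
    unfolding t0_sq_def N_def odds_def by simp
  have inv: "(1 - r) / (1 + r) = 1 / odds r" "(1 + r) / (1 - r) = odds r"
    unfolding odds_def by simp_all
  have pos: "0 < odds r" "0 < odds s"
    using odds_pos r s by auto
  have "h_at \<phi> s r = ereal (- ((1 / odds r + gamma0_sq \<phi> s * odds r) * (t0_sq \<phi> s / 2)))"
    using r s by (simp add: h_at_def h_gt_def sq inv)
  also have "- ((1 / odds r + gamma0_sq \<phi> s * odds r) * (t0_sq \<phi> s / 2)) = (N / q + P * q) / 4"
  proof -
    have "t0_sq \<phi> s / 2 = - (odds s * N) / 4"
      unfolding t by simp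
    moreover have "- ((x + y) * (- k / 4)) = (x * k + y * k) / 4" for x y k :: real
      by (simp add: distrib_right)
    moreover have "1 / odds r * (odds s * N) = N / q"
      unfolding q_def by simp
    moreover have "P / N / (odds s)\<^sup>2 * odds r * (odds s * N) = P * q"
      unfolding q_def using N pos by (simp add: power2_eq_square)
    ultimately show ?thesis
      unfolding g by presburger
  qed
  also have "\<dots> = \<phi> s * (q + 1 / q) / 2 + (1 - s\<^sup>2) * D s / 4 * (q - 1 / q)"
    unfolding P_def N_def by (simp add: algebra_simps add_divide_distrib diff_divide_distrib)
  finally show ?thesis .
qed

text \<open>Both sides are linear in \<open>\<phi> s\<close> and \<open>D s\<close>, so the two
  coefficients are compared separately, in \<open>sym\<close> and \<open>antisym\<close>. The square
  reflects the contact of the two curves at \<open>q = 1\<close>.\<close>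

lemma tangent_minus_h:
  assumes s: "-1 < s" "s < 1" and r: "-1 < r" "r < 1"
  defines "q \<equiv> odds r / odds s"
  shows "\<phi> s + D s * (r - s) - (\<phi> s * (q + 1 / q) / 2 + (1 - s\<^sup>2) * D s / 4 * (q - 1 / q))
    = (q - 1)\<^sup>2 / (4 * q) * (- 2 * \<phi> s - r * ((1 - s\<^sup>2) * D s))"
proof -
  have q: "q = ((1 + r) * (1 - s)) / ((1 - r) * (1 + s))"
    unfolding q_def odds_def by simp
  have nz: "1 + r \<noteq> 0" "1 - r \<noteq> 0" "1 + s \<noteq> 0" "1 - s \<noteq> 0"
    using r s by auto
  have q0: "q \<noteq> 0" using q nz by simp
  have sym: "\<phi> s - \<phi> s * (q + 1 / q) / 2 = (q - 1)\<^sup>2 / (4 * q) * (- 2 * \<phi> s)"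
    using q0 by (simp add: field_simps power2_eq_square)
  have antisym: "(r - s) - (1 - s\<^sup>2) / 4 * (q - 1 / q) = - ((q - 1)\<^sup>2 / (4 * q) * (r * (1 - s\<^sup>2)))"
  proof -
    have qm: "q - 1 = 2 * (r - s) / ((1 - r) * (1 + s))"
      unfolding q using nz by (simp add: divide_simps) (simp add: algebra_simps)
    have qp: "(q + 1) = 2 * (1 - r * s) / ((1 - r) * (1 + s))"
      unfolding q using nz by (simp add: divide_simps) (simp add: algebra_simps)
    have s2: "1 - s\<^sup>2 = (1 - s) * (1 + s)"
      by (simp add: power2_eq_square algebra_simps)
    have "(1 - s\<^sup>2) / 4 * (q - 1 / q) = (1 - s) * (1 + s) / 4 * ((q - 1) * (q + 1) / q)"
      unfolding s2 using q0 by (simp add: field_simps)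
    also have "\<dots> = (r - s) * (1 - r * s) / ((1 - r) * (1 + r))"
      unfolding qm qp unfolding q using nz by (simp add: divide_simps) (simp add: algebra_simps)
    finally have 1: "(1 - s\<^sup>2) / 4 * (q - 1 / q) = (r - s) * (1 - r * s) / ((1 - r) * (1 + r))" .
    have 2: "(q - 1)\<^sup>2 / (4 * q) * (r * (1 - s\<^sup>2)) = (r - s)\<^sup>2 * r / ((1 - r) * (1 + r))"
      unfolding qm s2 unfolding q using nz
      by (simp add: divide_simps power2_eq_square) (simp add: algebra_simps)
    define d where "d = (1 - r) * (1 + r)"
    have "(r - s) - (r - s) * (1 - r * s) / d = ((r - s) * d - (r - s) * (1 - r * s)) / d"
      using nz unfolding d_def by (simp add: diff_divide_distrib)
    \<comment> \<open>Here \<open>d - (1 - r * s) = r * (s - r)\<close>, which produces the second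
      factor \<open>r - s\<close>.\<close>
    also have "(r - s) * d - (r - s) * (1 - r * s) = - ((r - s)\<^sup>2 * r)"
      unfolding d_def by algebra
    finally show ?thesis
      unfolding 1 2 d_def[symmetric] by simp
  qed
  have "A + d * (r - s) - (A * x / 2 + p * d / 4 * y) = (A - A * x / 2) + d * ((r - s) - p / 4 * y)"
    for A d p x y :: real
    by (simp add: right_diff_distrib)
  moreover have "k * (- 2 * A) + d * - (k * (r * p)) = k * (- 2 * A - r * (p * d))"
    for k A d p :: real
    by (simp add: algebra_simps)
  ultimately show ?thesis
    using sym antisym by presburger
qed

text \<open>The last factor in \<open>tangent_minus_h\<close> is affine in \<open>r\<close> and
  positive at both ends by \<open>coefficients_neg\<close>, so the function is below the tangent,
  which is below \<open>\<phi>\<close>.\<close>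

lemma h_at_interior_le:
  assumes s: "-1 < s" "s < 1" and r: "r \<in> {-1..1}"
  shows "h_at \<phi> s r \<le> ereal (\<phi> r)"
proof -
  \<comment> \<open>At either end point one of the two poles has a positive coefficient, so the
    value is minus infinity.\<close>
  consider "r = -1" | "r = 1" | "-1 < r" "r < 1"
    using r by force
  then show ?thesis
  proof cases
    case 1
    then show ?thesis
      using s t0_sq_pos[OF s] by (simp add: h_at_def h_gt_def)
  next
    case 2
    then show ?thesis
      using s t0_sq_pos[OF s] gamma0_sq_pos[OF s] by (simp add: h_at_def h_gt_def)
  next
    case 3
    have "\<bar>r * ((1 - s\<^sup>2) * D s)\<bar> \<le> 1 * \<bar>(1 - s\<^sup>2) * D s\<bar>"
      unfolding abs_mult[of r] using 3 by (intro mult_right_mono) auto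
    then have "0 \<le> - 2 * \<phi> s - r * ((1 - s\<^sup>2) * D s)"
      using coefficients_neg[OF s] by linarith
    then have "0 \<le> (odds r / odds s - 1)\<^sup>2 / (4 * (odds r / odds s))
        * (- 2 * \<phi> s - r * ((1 - s\<^sup>2) * D s))"
      using odds_pos[OF s] odds_pos[OF 3] by simp
    then show ?thesis
      using tangent_minus_h[OF s 3] h_at_interior[OF s 3] tangent_le[OF r, of s] s by simp
  qed
qed

lemma h_at_interior_ge:
  assumes s: "-1 < s" "s < 1" and r: "-1 < r" "r < 1"
    and d: "\<bar>ln (odds r) - ln (odds s)\<bar> \<le> e" "e \<le> 1" and D: "\<bar>D r - D s\<bar> \<le> w"
  shows "ereal (\<phi> r - (2 * w * e + e\<^sup>2 * (2 * M + L))) \<le> h_at \<phi> s r"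
proof -
  define q where "q = odds r / odds s"
  have I: "r \<in> {-1..1}" "s \<in> {-1..1}" using r s by auto
  have w: "0 \<le> w" using D by linarith
  \<comment> \<open>The tangent at \<open>r\<close>, evaluated at \<open>s\<close>, bounds the
    convexity gap from above.\<close>
  have "\<phi> r - \<phi> s - D s * (r - s) \<le> (D r - D s) * (r - s)"
    using tangent_le[OF I(2,1)] by (simp add: algebra_simps)
  also have "\<dots> \<le> \<bar>D r - D s\<bar> * \<bar>r - s\<bar>"
    by (metis abs_ge_self abs_mult)
  also have "\<dots> \<le> w * (2 * e)"
    using D odds_close(1)[OF r s d] w by (intro mult_mono) auto
  finally have 1: "\<phi> r - \<phi> s - D s * (r - s) \<le> 2 * w * e" by simp
  have "\<bar>r * ((1 - s\<^sup>2) * D s)\<bar> \<le> 1 * (1 * L)"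
    unfolding abs_mult using r s abs_D_le[OF I(2)] L_pos
    by (intro mult_mono) (auto simp: abs_square_le_1 abs_le_iff power_le_one_iff)
  then have "- 2 * \<phi> s - r * ((1 - s\<^sup>2) * D s) \<le> 2 * M + L"
    using bound[OF I(2)] by linarith
  then have "(q - 1)\<^sup>2 / (4 * q) * (- 2 * \<phi> s - r * ((1 - s\<^sup>2) * D s))
      \<le> (q - 1)\<^sup>2 / (4 * q) * (2 * M + L)"
    using odds_pos[OF r] odds_pos[OF s] unfolding q_def by (intro mult_left_mono) auto
  also have "\<dots> \<le> e\<^sup>2 * (2 * M + L)"
    using odds_close(2)[OF r s d] L_pos M_nonneg unfolding q_def by (intro mult_right_mono) auto
  finally show ?thesis
    using 1 tangent_minus_h[OF s r] h_at_interior[OF s r] unfolding q_def by simp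
qed

section \<open>The functions attached to the end points\<close>

text \<open>The comparison is with the tangent at 1. For a positive slope,
  \<open>1 + r \<le> 2\<close> puts the function below that tangent; otherwise it is the constant
  \<open>\<phi> 1\<close>, and the tangent lies above this constant.\<close>

lemma h_at_one_le:
  assumes r: "r \<in> {-1..1}"
  shows "h_at \<phi> 1 r \<le> ereal (\<phi> r)"
proof -
  have t: "\<phi> 1 + D 1 * (r - 1) \<le> \<phi> r"
    using tangent_le[OF r, of 1] by simp
  show ?thesis
  proof (cases "D 1 \<le> 0")
    case True
    then have "0 \<le> D 1 * (r - 1)"
      using r by (intro mult_nonpos_nonpos) auto
    then show ?thesis
      \<comment> \<open>The zero coefficient annihilates the infinite factor at
        \<open>r = -1\<close>.\<close>
      using t True by (simp add: h_at_def h_plus1_def max_absorb2)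
  next
    case False
    show ?thesis
    proof (cases "r = -1")
      case True
      then show ?thesis
        using False by (simp add: h_at_def h_plus1_def max_absorb1)
    next
      case r': False
      have "(1 - r) / 2 \<le> (1 - r) / (1 + r)"
        using r r' by (intro divide_left_mono) auto
      then have "D 1 * (1 - r) \<le> (1 - r) / (1 + r) * (4 * D 1 / 2)"
        using mult_left_mono[of "(1 - r) / 2" "(1 - r) / (1 + r)" "2 * D 1"] False
        by (simp add: mult.commute)
      then show ?thesis
        using False r r' t by (simp add: h_at_def h_plus1_def max_absorb1 algebra_simps)
    qed
  qed
qed

text \<open>The fractional term costs at most \<open>2 * L * (1 - r)\<close> because
  \<open>1 + r\<close> is at least 1, and the Lipschitz bound costs a further
  \<open>L * (1 - r)\<close>.\<close>

lemma h_at_one_ge: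
  assumes r: "0 \<le> r" "r \<le> 1"
  shows "ereal (\<phi> r - 3 * L * (1 - r)) \<le> h_at \<phi> 1 r"
proof -
  have m: "0 \<le> max (D 1) 0" "max (D 1) 0 \<le> L"
    using abs_D_le[of 1] L_pos by auto
  have "(1 - r) / (1 + r) \<le> (1 - r) / 1"
    using r by (intro divide_left_mono) auto
  then have "(1 - r) / (1 + r) * (4 * max (D 1) 0 / 2) \<le> (1 - r) * (2 * L)"
    using m r by (intro mult_mono) auto
  moreover have "\<phi> r - \<phi> 1 \<le> L * (1 - r)"
    using lipschitz_onD[OF lip, of r 1] r by (simp add: dist_real_def)
  ultimately have "\<phi> r - 3 * L * (1 - r)
      \<le> - ((1 - r) / (1 + r) * (4 * max (D 1) 0 / 2)) + \<phi> 1"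
    by (simp add: algebra_simps)
  moreover have "h_at \<phi> 1 r = ereal (- ((1 - r) / (1 + r) * (4 * max (D 1) 0 / 2)) + \<phi> 1)"
    using r by (simp add: h_at_def h_plus1_def)
  ultimately show ?thesis by simp
qed

lemma reflect_has_derivative:
  assumes "r \<in> {-1..1}"
  shows "((\<lambda>x. \<phi> (- x)) has_real_derivative - D (- r)) (at r within {-1..1})"
proof (rule DERIV_image_chain[where f = \<phi> and g = "\<lambda>x. - x", unfolded o_def, THEN DERIV_cong])
  show "((\<lambda>x. - x) has_real_derivative - 1) (at r within {-1..1})"
    by (auto intro!: derivative_eq_intros)
  show "(\<phi> has_real_derivative D (- r)) (at (- r) within (\<lambda>x. - x) ` {-1..1})"
    using assms by (auto intro!: has_field_derivative_subset[OF has_derivative_D])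
qed simp

text \<open>Reflection exchanges the end points, so the estimates at -1 follow from those at
  1.\<close>

lemma reflect: "convex_profile (\<lambda>x. \<phi> (- x)) L M"
proof
  show "convex_on {-1..1} (\<lambda>x. \<phi> (- x))"
  proof (rule convex_onI)
    show "\<phi> (- ((1 - t) *\<^sub>R x + t *\<^sub>R y)) \<le> (1 - t) * \<phi> (- x) + t * \<phi> (- y)"
      if "0 < t" "t < 1" "x \<in> {-1..1}" "y \<in> {-1..1}" for t x y
      using convex_onD[OF convex, of t "- x" "- y"] that by (simp add: algebra_simps)
  qed simp
  show "\<phi> (- r) \<le> 0" if "r \<in> {-1..1}" for r using nonpos[of "- r"] that by auto
  show "\<bar>\<phi> (- r)\<bar> \<le> M" if "r \<in> {-1..1}" for r using bound[of "- r"] that by auto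
  show "\<not> (\<lambda>x. \<phi> (- x)) constant_on {-1..1}"
  proof
    assume "(\<lambda>x. \<phi> (- x)) constant_on {-1..1}"
    then obtain c where c: "\<And>x. x \<in> {-1..1} \<Longrightarrow> \<phi> (- x) = c"
      unfolding constant_on_def by blast
    have "\<phi> x = c" if "x \<in> {-1..1}" for x using c[of "- x"] that by auto
    then show False using nonconst unfolding constant_on_def by blast
  qed
  show "(\<lambda>x. \<phi> (- x)) differentiable_on {-1..1}"
    unfolding differentiable_on_def
    using reflect_has_derivative real_differentiable_def by blast
  show "L-lipschitz_on {-1..1} (\<lambda>x. \<phi> (- x))"
  proof (rule lipschitz_onI)
    show "dist (\<phi> (- x)) (\<phi> (- y)) \<le> L * dist x y" if "x \<in> {-1..1}" "y \<in> {-1..1}" for x y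
      using lipschitz_onD[OF lip, of "- x" "- y"] that by (simp add: dist_minus)
  qed (use L_pos in simp)
qed

lemma reflect_D:
  assumes "r \<in> {-1..1}"
  shows "dphi (\<lambda>x. \<phi> (- x)) r = - D (- r)"
proof -
  have "((\<lambda>x. \<phi> (- x)) has_vector_derivative - D (- r)) (at r within {-1..1})"
    using reflect_has_derivative[OF assms]
    by (simp add: has_real_derivative_iff_has_vector_derivative)
  then show ?thesis
    unfolding dphi_def using assms vector_derivative_within_cbox[of "-1" 1 r] by simp
qed

lemma reflect_h_at: "h_at (\<lambda>x. \<phi> (- x)) 1 (- r) = h_at \<phi> (- 1) r"
  using reflect_D[of 1] by (simp add: h_at_def h_plus1_def h_minus1_def)

lemma h_at_minus_one_le: "r \<in> {-1..1} \<Longrightarrow> h_at \<phi> (-1) r \<le> ereal (\<phi> r)"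
  using convex_profile.h_at_one_le[OF reflect, of "- r"] by (simp add: reflect_h_at)

lemma h_at_minus_one_ge: "-1 \<le> r \<Longrightarrow> r \<le> 0 \<Longrightarrow> ereal (\<phi> r - 3 * L * (1 + r)) \<le> h_at \<phi> (-1) r"
  using convex_profile.h_at_one_ge[OF reflect, of "- r"] by (simp add: reflect_h_at)

lemma h_at_le: "s \<in> {-1..1} \<Longrightarrow> r \<in> {-1..1} \<Longrightarrow> h_at \<phi> s r \<le> ereal (\<phi> r)"
  using h_at_one_le[of r] h_at_minus_one_le[of r] h_at_interior_le[of s r]
  by (cases "s = 1"; cases "s = -1") auto

section \<open>Choice of the grids and count of the points\<close>

lemma approximating_set:
  assumes "0 < \<epsilon>" "3 * \<epsilon> \<le> L"
  obtains T where "T \<subseteq> {-1..1}" "finite T"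
    "real (card T) \<le> (9 + 4 * sqrt (1 + 2 * (M / L))) * (sqrt (L / \<epsilon>) * ln (L / \<epsilon>))"
    "\<And>r. r \<in> {-1..1} \<Longrightarrow> \<exists>s\<in>T. ereal (\<phi> r - 2 * \<epsilon>) \<le> h_at \<phi> s r"
proof -
  \<comment> \<open>The budget is \<open>2 * \<epsilon>\<close>: \<open>e\<close> makes the distance
    to the tangent at most \<open>\<epsilon>\<close>, \<open>w\<close> does the same for the
    convexity gap, and \<open>\<delta>\<close> satisfies
    \<open>3 * L * \<delta> = 2 * \<epsilon>\<close> near the end points.\<close>
  define e where "e = sqrt (\<epsilon> / (2 * M + L))"
  define w where "w = sqrt (\<epsilon> * L) / 2"
  define \<delta> where "\<delta> = 2 * \<epsilon> / (3 * L)"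
  define x where "x = L / \<epsilon>"
  define S where "S = {- (1 - \<delta>) .. 1 - \<delta>}"
  have x3: "3 \<le> x"
    unfolding x_def using assms by (simp add: field_simps)
  have lnx: "1 \<le> ln x"
  proof -
    have "exp 1 \<le> x" using e_less_272 x3 by linarith
    then show ?thesis using x3 by (simp add: ln_ge_iff)
  qed
  have sx: "1 \<le> sqrt x" using x3 by simp
  have twoM_L_pos: "0 < 2 * M + L" using L_pos M_nonneg by simp
  have pos: "0 < e" "0 < w" "0 < \<delta>"
    unfolding e_def w_def \<delta>_def using assms L_pos twoM_L_pos by auto
  have \<delta>1: "\<delta> < 1"
    unfolding \<delta>_def using assms L_pos by (simp add: field_simps)
  have e2: "e\<^sup>2 * (2 * M + L) = \<epsilon>"
    unfolding e_def using assms twoM_L_pos by simp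
  have e1: "e \<le> 1"
    unfolding e_def using assms twoM_L_pos M_nonneg by simp
  have we: "2 * w * e \<le> \<epsilon>"
  proof -
    have "e \<le> sqrt (\<epsilon> / L)"
      unfolding e_def using assms twoM_L_pos M_nonneg L_pos by (simp add: frac_le)
    then have "2 * w * e \<le> sqrt (\<epsilon> * L) * sqrt (\<epsilon> / L)"
      unfolding w_def using assms L_pos by (auto intro!: mult_left_mono)
    also have "\<dots> = \<epsilon>"
      using assms L_pos by (simp flip: real_sqrt_mult)
    finally show ?thesis .
  qed
  have Lw: "L / w = 2 * sqrt x"
  proof -
    have "sqrt (\<epsilon> * L) * sqrt x = L"
      unfolding x_def using assms L_pos by (simp flip: real_sqrt_mult)
    then show ?thesis
      unfolding w_def using assms L_pos by (simp add: field_simps)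
  qed
  have inv_e: "1 / e = sqrt (1 + 2 * (M / L)) * sqrt x"
  proof -
    have "(1 + 2 * (M / L)) * x = (2 * M + L) / \<epsilon>"
      unfolding x_def using L_pos assms by (simp add: field_simps)
    then show ?thesis
      unfolding e_def by (simp flip: real_sqrt_mult add: real_sqrt_divide)
  qed
  have SI: "-1 < r \<and> r < 1" if "r \<in> S" for r
    using that pos unfolding S_def by auto
  have ln_odds: "\<bar>ln (odds r)\<bar> \<le> 2 * ln x" if "r \<in> S" for r
  proof -
    \<comment> \<open>The odds are \<open>(2 - \<delta>) / \<delta>\<close>, and
      \<open>2 / \<delta> = 3 * x\<close>. Later \<open>3 \<le> x\<close> absorbs the factor 3 into
      a second \<open>x\<close>.\<close>
    have b: "odds (1 - \<delta>) \<le> 3 * x"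
      unfolding odds_def \<delta>_def x_def using assms L_pos by (simp add: field_simps)
    have m: "odds (- (1 - \<delta>)) = 1 / odds (1 - \<delta>)"
      unfolding odds_def by simp
    have "odds r \<le> odds (1 - \<delta>)" "odds (- (1 - \<delta>)) \<le> odds r"
      using that pos \<delta>1 unfolding S_def by (auto intro!: odds_mono)
    moreover have p: "0 < odds (1 - \<delta>)" "0 < odds r"
      using odds_pos SI[OF that] pos \<delta>1 by auto
    ultimately have "ln (odds r) \<le> ln (odds (1 - \<delta>))" "ln (1 / odds (1 - \<delta>)) \<le> ln (odds r)"
      unfolding m by (auto intro!: ln_mono)
    moreover have "ln (odds (1 - \<delta>)) \<le> ln (3 * x)"
      using b p by (intro ln_mono) auto
    moreover have "ln (3 * x) \<le> ln (x * x)"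
      using x3 by (intro ln_mono) auto
    moreover have "ln (x * x) = 2 * ln x"
      using x3 by (simp add: ln_mult)
    moreover have "ln (1 / odds (1 - \<delta>)) = - ln (odds (1 - \<delta>))"
      using p by (simp add: ln_div)
    ultimately show ?thesis
      by linarith
  qed
  \<comment> \<open>Division by \<open>w\<close> and \<open>e\<close> gives both grids unit width.
    Since both functions increase, the cell counts add instead of multiplying: order
    \<open>sqrt x\<close> for the slopes and \<open>sqrt x * ln x\<close> for the odds.\<close>
  obtain T where T: "T \<subseteq> S" "finite T"
    "real (card T) \<le> 2 * (L / w) + 2 * (2 * ln x / e) + 3"
    "\<And>r. r \<in> S \<Longrightarrow> \<exists>s\<in>T. \<bar>D r / w - D s / w\<bar> \<le> 1 \<and> \<bar>ln (odds r) / e - ln (odds s) / e\<bar> \<le> 1"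
  proof (rule finite_representatives_of_steps)
    show "mono_on S (\<lambda>r. D r / w)"
      using SI pos by (auto intro!: mono_onI divide_right_mono mono_onD[OF D_mono] simp: less_imp_le)
    show "\<bar>D r / w\<bar> \<le> L / w" if "r \<in> S" for r
      using abs_D_le[of r] SI[OF that] pos by (simp add: abs_divide divide_right_mono)
    show "mono_on S (\<lambda>r. ln (odds r) / e)"
      using SI pos by (auto intro!: mono_onI divide_right_mono ln_mono odds_mono odds_pos)
    show "\<bar>ln (odds r) / e\<bar> \<le> 2 * ln x / e" if "r \<in> S" for r
      using ln_odds[OF that] pos by (simp add: abs_divide divide_right_mono)
    show "0 \<le> L / w" "0 \<le> 2 * ln x / e"
      using L_pos pos lnx by auto
  qed (rule that)
  show ?thesis
  proof
    show "insert 1 (insert (-1) T) \<subseteq> {-1..1}"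
      using T(1) SI by force
    show "finite (insert 1 (insert (-1) T))"
      using T(2) by simp
    have "card (insert 1 (insert (-1) T)) \<le> card T + 2"
      using T(2) by (simp add: card_insert_if)
    \<comment> \<open>The 5 is the 3 from rounding plus the two end points.\<close>
    then have "real (card (insert 1 (insert (-1) T))) \<le> 2 * (L / w) + 4 * ln x * (1 / e) + 5"
      using T(3) by simp
    also have "\<dots> = 4 * sqrt x + 4 * sqrt (1 + 2 * (M / L)) * (sqrt x * ln x) + 5"
      unfolding Lw inv_e by simp
    \<comment> \<open>As \<open>sqrt x\<close> and 1 are at most \<open>sqrt x * ln x\<close>, the
      terms with 4 and 5 add up to the 9.\<close>
    also have "\<dots> \<le> (9 + 4 * sqrt (1 + 2 * (M / L))) * (sqrt x * ln x)"
    proof -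
      have "sqrt x \<le> sqrt x * ln x" using lnx sx by simp
      then show ?thesis using sx unfolding distrib_right by linarith
    qed
    finally show "real (card (insert 1 (insert (-1) T)))
        \<le> (9 + 4 * sqrt (1 + 2 * (M / L))) * (sqrt (L / \<epsilon>) * ln (L / \<epsilon>))"
      unfolding x_def .
    show "\<exists>s\<in>insert 1 (insert (-1) T). ereal (\<phi> r - 2 * \<epsilon>) \<le> h_at \<phi> s r"
      if r: "r \<in> {-1..1}" for r
    proof -
      have \<delta>L: "3 * L * \<delta> = 2 * \<epsilon>"
        unfolding \<delta>_def using L_pos by simp
      consider "1 - \<delta> < r" | "r < - (1 - \<delta>)" | "r \<in> S"
        unfolding S_def by force
      then show ?thesis
      proof cases
        case 1
        then have "3 * L * (1 - r) \<le> 3 * L * \<delta>"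
          using L_pos by (intro mult_left_mono) auto
        then have "ereal (\<phi> r - 2 * \<epsilon>) \<le> ereal (\<phi> r - 3 * L * (1 - r))"
          using \<delta>L by simp
        also have "\<dots> \<le> h_at \<phi> 1 r"
          using h_at_one_ge[of r] 1 r \<delta>1 by simp
        finally show ?thesis by blast
      next
        case 2
        then have "3 * L * (1 + r) \<le> 3 * L * \<delta>"
          using L_pos by (intro mult_left_mono) auto
        then have "ereal (\<phi> r - 2 * \<epsilon>) \<le> ereal (\<phi> r - 3 * L * (1 + r))"
          using \<delta>L by simp
        also have "\<dots> \<le> h_at \<phi> (-1) r"
          using h_at_minus_one_ge[of r] 2 r \<delta>1 by simp
        finally show ?thesis by blast
      next
        case 3
        obtain s where s: "s \<in> T" "\<bar>D r / w - D s / w\<bar> \<le> 1"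
          "\<bar>ln (odds r) / e - ln (odds s) / e\<bar> \<le> 1"
          using T(4)[OF 3] by blast
        have "\<bar>D r - D s\<bar> \<le> w" "\<bar>ln (odds r) - ln (odds s)\<bar> \<le> e"
          using s(2,3) pos by (simp_all flip: diff_divide_distrib add: abs_divide)
        then have "ereal (\<phi> r - (2 * w * e + e\<^sup>2 * (2 * M + L))) \<le> h_at \<phi> s r"
          using SI[OF 3] SI[of s] T(1) s(1) e1 by (intro h_at_interior_ge) auto
        moreover have "ereal (\<phi> r - 2 * \<epsilon>) \<le> ereal (\<phi> r - (2 * w * e + e\<^sup>2 * (2 * M + L)))"
          using e2 we by simp
        ultimately have "ereal (\<phi> r - 2 * \<epsilon>) \<le> h_at \<phi> s r"
          by (rule order_trans[rotated])
        then show ?thesis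
          using s(1) by blast
      qed
    qed
  qed
qed

end

text \<open>The implied constant is a function of the ratio of the supremum of
  \<open>\<bar>\<phi>\<bar>\<close> to the Lipschitz constant: the width \<open>e\<close>
  contributes the factor \<open>sqrt (1 + 2 * (M / L))\<close>. The size bound is asymptotic, hence
  the threshold; the approximation holds for every positive \<open>\<epsilon>\<close>.\<close>

theorem theorem7:
  "\<exists>(C :: real \<Rightarrow> real) (x\<^sub>0 :: real). mono C \<and>
     (\<forall>(\<phi> :: real \<Rightarrow> real) (\<epsilon> :: real).
        convex_on {-1..1} \<phi> \<longrightarrow>
        (\<forall>\<rho>\<in>{-1..1}. \<phi> \<rho> \<le> 0) \<longrightarrow>
        \<not> \<phi> constant_on {-1..1} \<longrightarrow>
        \<phi> differentiable_on {-1..1} \<longrightarrow>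
        (\<exists>L. L-lipschitz_on {-1..1} \<phi>) \<longrightarrow>
        \<epsilon> > 0 \<longrightarrow>
        (\<exists>T \<subseteq> {-1..1}.
           finite T \<and>
           (lip_const \<phi> / \<epsilon> \<ge> x\<^sub>0 \<longrightarrow>
              real (card T) \<le> C ((SUP \<rho>\<in>{-1..1}. \<bar>\<phi> \<rho>\<bar>) / lip_const \<phi>) *
                (sqrt (lip_const \<phi> / \<epsilon>) * ln (lip_const \<phi> / \<epsilon>))) \<and>
           (\<forall>\<rho>\<in>{-1..1}.
              0 \<le> ereal (\<phi> \<rho>) - (SUP \<rho>\<^sub>0\<in>T. h_at \<phi> \<rho>\<^sub>0 \<rho>) \<and>
              ereal (\<phi> \<rho>) - (SUP \<rho>\<^sub>0\<in>T. h_at \<phi> \<rho>\<^sub>0 \<rho>) \<le> ereal (2 * \<epsilon>))))"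
proof (intro exI[of _ "\<lambda>m. 9 + 4 * sqrt (1 + 2 * m)"] exI[of _ 3] conjI allI impI)
  show "mono (\<lambda>m::real. 9 + 4 * sqrt (1 + 2 * m))"
    by (rule monoI) simp
  fix \<phi> :: "real \<Rightarrow> real" and \<epsilon> :: real
  assume convex: "convex_on {-1..1} \<phi>" and nonpos: "\<forall>\<rho>\<in>{-1..1}. \<phi> \<rho> \<le> 0"
    and nonconst: "\<not> \<phi> constant_on {-1..1}" and diff: "\<phi> differentiable_on {-1..1}"
    and lip: "\<exists>L. L-lipschitz_on {-1..1} \<phi>" and \<epsilon>: "\<epsilon> > 0"
  define L where "L = lip_const \<phi>"
  define M where "M = (SUP \<rho>\<in>{-1..1}. \<bar>\<phi> \<rho>\<bar>)"
  \<comment> \<open>Compactness bounds the set of values, so the real supremum \<open>M\<close>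
    really is an upper bound.\<close>
  have "continuous_on {-1..1} (\<lambda>\<rho>. \<bar>\<phi> \<rho>\<bar>)"
    using differentiable_imp_continuous_on[OF diff] by (intro continuous_intros)
  then have "compact ((\<lambda>\<rho>. \<bar>\<phi> \<rho>\<bar>) ` {-1..1})"
    by (rule compact_continuous_image) simp
  then have bdd: "bdd_above ((\<lambda>\<rho>. \<bar>\<phi> \<rho>\<bar>) ` {-1..1})"
    by (intro bounded_imp_bdd_above compact_imp_bounded)
  interpret convex_profile \<phi> L M
  proof
    show "L-lipschitz_on {-1..1} \<phi>"
      unfolding L_def lip_const_def by (rule Inf_lipschitz_on[OF lip])
    show "\<bar>\<phi> r\<bar> \<le> M" if "r \<in> {-1..1}" for r
      unfolding M_def using bdd that by (rule cSUP_upper2) simp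
  qed (use convex nonpos nonconst diff in auto)
  \<comment> \<open>For large \<open>\<epsilon>\<close> a smaller tolerance meets the hypothesis of
    \<open>approximating_set\<close>; above the threshold 3 nothing changes.\<close>
  define \<epsilon>' where "\<epsilon>' = min \<epsilon> (L / 3)"
  have \<epsilon>': "0 < \<epsilon>'" "3 * \<epsilon>' \<le> L"
    unfolding \<epsilon>'_def using \<epsilon> L_pos by auto
  obtain T where T: "T \<subseteq> {-1..1}" "finite T"
    "real (card T) \<le> (9 + 4 * sqrt (1 + 2 * (M / L))) * (sqrt (L / \<epsilon>') * ln (L / \<epsilon>'))"
    "\<And>r. r \<in> {-1..1} \<Longrightarrow> \<exists>s\<in>T. ereal (\<phi> r - 2 * \<epsilon>') \<le> h_at \<phi> s r"
    by (rule approximating_set[OF \<epsilon>']) (rule that)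
  show "\<exists>T\<subseteq>{-1..1}. finite T \<and>
      (lip_const \<phi> / \<epsilon> \<ge> 3 \<longrightarrow>
        real (card T) \<le> (9 + 4 * sqrt (1 + 2 * ((SUP \<rho>\<in>{-1..1}. \<bar>\<phi> \<rho>\<bar>) / lip_const \<phi>))) *
          (sqrt (lip_const \<phi> / \<epsilon>) * ln (lip_const \<phi> / \<epsilon>))) \<and>
      (\<forall>\<rho>\<in>{-1..1}.
        0 \<le> ereal (\<phi> \<rho>) - (SUP \<rho>\<^sub>0\<in>T. h_at \<phi> \<rho>\<^sub>0 \<rho>) \<and>
        ereal (\<phi> \<rho>) - (SUP \<rho>\<^sub>0\<in>T. h_at \<phi> \<rho>\<^sub>0 \<rho>) \<le> ereal (2 * \<epsilon>))"
    unfolding L_def[symmetric] M_def[symmetric]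
  proof (intro exI[of _ T] conjI impI ballI T(1,2))
    assume "3 \<le> L / \<epsilon>"
    then have "\<epsilon>' = \<epsilon>"
      unfolding \<epsilon>'_def using \<epsilon> by (simp add: pos_le_divide_eq)
    then show "real (card T) \<le> (9 + 4 * sqrt (1 + 2 * (M / L))) * (sqrt (L / \<epsilon>) * ln (L / \<epsilon>))"
      using T(3) by simp
  next
    fix r :: real
    assume r: "r \<in> {-1..1}"
    have "(SUP s\<in>T. h_at \<phi> s r) \<le> ereal (\<phi> r)"
      using h_at_le[OF _ r] T(1) by (auto intro!: SUP_least)
    then show "0 \<le> ereal (\<phi> r) - (SUP s\<in>T. h_at \<phi> s r)"
      by (rule ereal_diff_positive)
    obtain s where s: "s \<in> T" "ereal (\<phi> r - 2 * \<epsilon>') \<le> h_at \<phi> s r"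
      using T(4)[OF r] by blast
    have "ereal (\<phi> r - 2 * \<epsilon>) \<le> ereal (\<phi> r - 2 * \<epsilon>')"
      unfolding \<epsilon>'_def by simp
    also have "\<dots> \<le> (SUP s\<in>T. h_at \<phi> s r)"
      using s by (rule SUP_upper2)
    finally have "ereal (\<phi> r) - (SUP s\<in>T. h_at \<phi> s r) \<le> ereal (\<phi> r) - ereal (\<phi> r - 2 * \<epsilon>)"
      by (intro ereal_minus_mono) auto
    then show "ereal (\<phi> r) - (SUP s\<in>T. h_at \<phi> s r) \<le> ereal (2 * \<epsilon>)"
      by simp
  qed
qed

end
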